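(* Let $p$ be a prime, $d\ge1$, and consider on $\mathbb{Q}_p^d$ the deformed metric $$\widetilde d(x,y)=\max_{1\le l\le d}\left(q_l|x_l-y_l|_p\right)$$ with parameters $q_1\le q_2\le\dots\le q_d$ from $(p^{-1},1]$. Let $0=d_0<d_1<\dots<d_r=d$ be the integers such that $q_a=q_b$ if and only if $a,b$ lie in the same interval $(d_{i-1},d_i]$. Then the group $O(\widetilde d)$ of linear isometries of $\mathbb{Q}_p^d$ for this metric is the subgroup of $O_d$ consisting of the matrices $A\in O_d$ which are block upper triangular $\mathrm{mod}\ p$, i.e. such that $A_{ab}\in p\mathbb{Z}_p$ for all $a>b$ which do not lie in a common interval $(d_{i-1},d_i]$ (equivalently, for all $a>b$ with $q_a\ne q_b$).
   Context: $O_d$ is the group of linear transformations of $\mathbb{Q}_p^d$ which preserve the standard metric $|x-y|_p=\max_{1\le l\le d}|x_l-y_l|_p$; equivalently, the group of $d\times d$ matrices with entries in $\mathbb{Z}_p$ and $|\det|_p=1$. *)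

theory Defs
  imports
    "HOL-Analysis.Analysis"
    "HOL-Algebra.Group"
    "Jordan_Normal_Form.Matrix"
    "Berlekamp_Zassenhaus.Finite_Field"
begin

section \<open>The \<open>p\<close>-adic absolute value on the rationals\<close>

definition padic_val :: "nat \<Rightarrow> rat \<Rightarrow> int" where
  "padic_val p x =
     int (multiplicity (int p) (fst (quotient_of x))) - int (multiplicity (int p) (snd (quotient_of x)))"

definition padic_abs :: "nat \<Rightarrow> rat \<Rightarrow> real" where
  "padic_abs p x = (if x = 0 then 0 else real p powi (- padic_val p x))"

definition padic_Cauchy :: "nat \<Rightarrow> (nat \<Rightarrow> rat) \<Rightarrow> bool" where
  "padic_Cauchy p X \<longleftrightarrow> (\<forall>e>0. \<exists>N. \<forall>m\<ge>N. \<forall>n\<ge>N. padic_abs p (X m - X n) < e)"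

definition padic_null :: "nat \<Rightarrow> (nat \<Rightarrow> rat) \<Rightarrow> bool" where
  "padic_null p X \<longleftrightarrow> (\<lambda>n. padic_abs p (X n)) \<longlonglongrightarrow> 0"

lemma padic_abs_0 [simp]: "padic_abs p 0 = 0"
  by (simp add: padic_abs_def)

context
  fixes p :: nat
  assumes p: "prime p"
begin

lemma padic_abs_frac:
  assumes "a \<noteq> 0" "b \<noteq> 0"
  shows "padic_abs p (of_int a / of_int b) =
    real p powi (int (multiplicity (int p) b) - int (multiplicity (int p) a))"
proof -
  obtain n m where nm: "quotient_of (of_int a / of_int b) = (n, m)"
    by fastforce
  have m: "m > 0" using quotient_of_denom_pos[OF nm] .
  have eq: "(of_int a / of_int b :: rat) = of_int n / of_int m"
    using quotient_of_div[OF nm] .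
  with assms m have n: "n \<noteq> 0" by (auto simp: field_simps)
  from eq assms m have "(of_int (a * m) :: rat) = of_int (n * b)"
    by (simp add: field_simps)
  then have "a * m = n * b" by (simp only: of_int_eq_iff)
  then have "multiplicity (int p) (a * m) = multiplicity (int p) (n * b)" by simp
  moreover have "prime_elem (int p)" using p by simp
  ultimately have "multiplicity (int p) a + multiplicity (int p) m =
      multiplicity (int p) n + multiplicity (int p) b"
    using assms m n by (simp add: prime_elem_multiplicity_mult_distrib)
  then have "- padic_val p (of_int a / of_int b) =
      int (multiplicity (int p) b) - int (multiplicity (int p) a)"
    by (simp add: padic_val_def nm)
  then show ?thesis using assms by (simp add: padic_abs_def)
qed

lemma padic_rat_cases:
  fixes x :: rat
  assumes "x \<noteq> 0"
  obtains a b where "x = of_int a / of_int b" "a \<noteq> 0" "b \<noteq> 0"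
proof -
  obtain n m where nm: "quotient_of x = (n, m)" by fastforce
  show ?thesis
    using that[of n m] quotient_of_div[OF nm] quotient_of_denom_pos[OF nm] assms by auto
qed

lemma padic_abs_pos: "x \<noteq> 0 \<Longrightarrow> padic_abs p x > 0"
  using prime_gt_0_nat[OF p] by (simp add: padic_abs_def)

lemma padic_abs_nonneg [simp]: "padic_abs p x \<ge> 0"
  using padic_abs_pos[of x] by (cases "x = 0") auto

lemma padic_abs_eq_0_iff [simp]: "padic_abs p x = 0 \<longleftrightarrow> x = 0"
  using padic_abs_pos[of x] by (cases "x = 0") auto

lemma padic_abs_mult: "padic_abs p (x * y) = padic_abs p x * padic_abs p y"
proof (cases "x = 0 \<or> y = 0")
  case False
  then obtain a b c d where x: "x = of_int a / of_int b" "a \<noteq> 0" "b \<noteq> 0"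
    and y: "y = of_int c / of_int d" "c \<noteq> 0" "d \<noteq> 0"
    by (metis padic_rat_cases)
  have xy: "x * y = of_int (a * c) / of_int (b * d)" by (simp add: x y)
  have "prime_elem (int p)" using p by simp
  then have "multiplicity (int p) (a * c) = multiplicity (int p) a + multiplicity (int p) c"
    "multiplicity (int p) (b * d) = multiplicity (int p) b + multiplicity (int p) d"
    using x y by (simp_all add: prime_elem_multiplicity_mult_distrib)
  then have e: "int (multiplicity (int p) (b * d)) - int (multiplicity (int p) (a * c)) =
      (int (multiplicity (int p) b) - int (multiplicity (int p) a)) +
      (int (multiplicity (int p) d) - int (multiplicity (int p) c))"
    by simp
  have "real p \<noteq> 0" using prime_gt_0_nat[OF p] by simp
  moreover have "a * c \<noteq> 0" "b * d \<noteq> 0" using x y by auto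
  ultimately have "padic_abs p (x * y) =
      real p powi (int (multiplicity (int p) b) - int (multiplicity (int p) a)) *
      real p powi (int (multiplicity (int p) d) - int (multiplicity (int p) c))"
    unfolding xy by (subst padic_abs_frac) (simp_all only: e power_int_add not_False_eq_True simp_thms)
  then show ?thesis
    by (simp only: x(1) y(1) padic_abs_frac[OF x(2,3)] padic_abs_frac[OF y(2,3)])
qed auto

lemma padic_abs_1 [simp]: "padic_abs p 1 = 1"
  using padic_abs_frac[of 1 1] by simp

lemma padic_abs_minus [simp]: "padic_abs p (- x) = padic_abs p x"
proof -
  have "padic_abs p (- 1) = 1"
    using padic_abs_mult[of "- 1" "- 1"] padic_abs_nonneg[of "- 1"]
    by (simp add: square_eq_1_iff eq_commute[of 1])
  with padic_abs_mult[of "- 1" x] show ?thesis by simp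
qed

lemma padic_abs_minus_commute: "padic_abs p (x - y) = padic_abs p (y - x)"
  using padic_abs_minus[of "x - y"] by simp

lemma padic_abs_inverse: "padic_abs p (inverse x) = inverse (padic_abs p x)"
proof (cases "x = 0")
  case False
  then have "padic_abs p x * padic_abs p (inverse x) = 1"
    by (simp flip: padic_abs_mult)
  then show ?thesis by (simp add: inverse_unique)
qed simp

lemma padic_abs_add: "padic_abs p (x + y) \<le> max (padic_abs p x) (padic_abs p y)"
proof (cases "x = 0 \<or> y = 0 \<or> x + y = 0")
  case False
  then obtain a b c d where x: "x = of_int a / of_int b" "a \<noteq> 0" "b \<noteq> 0"
    and y: "y = of_int c / of_int d" "c \<noteq> 0" "d \<noteq> 0"
    by (metis padic_rat_cases)
  let ?m = "multiplicity (int p)"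
  have xy: "x + y = of_int (a * d + c * b) / of_int (b * d)"
    using x y by (simp add: field_simps)
  with False have "(of_int (a * d + c * b) :: rat) \<noteq> 0" by auto
  then have nz: "a * d + c * b \<noteq> 0" by (simp only: of_int_eq_0_iff not_False_eq_True)
  have pe: "prime_elem (int p)" using p by simp
  have nu: "\<not> is_unit (int p)" using p not_prime_1 by auto
  have m: "?m (a * d) = ?m a + ?m d" "?m (c * b) = ?m c + ?m b" "?m (b * d) = ?m b + ?m d"
    using x y pe by (simp_all add: prime_elem_multiplicity_mult_distrib)
  have "int p ^ min (?m (a * d)) (?m (c * b)) dvd a * d + c * b"
    by (intro dvd_add multiplicity_dvd') auto
  then have "min (?m (a * d)) (?m (c * b)) \<le> ?m (a * d + c * b)"
    using nz nu by (intro multiplicity_geI) auto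
  then have "int (?m (b * d)) - int (?m (a * d + c * b)) \<le>
      max (int (?m b) - int (?m a)) (int (?m d) - int (?m c))"
    unfolding m by linarith
  moreover have p1: "real p \<ge> 1" using prime_gt_0_nat[OF p] by linarith
  ultimately have "real p powi (int (?m (b * d)) - int (?m (a * d + c * b))) \<le>
      real p powi (max (int (?m b) - int (?m a)) (int (?m d) - int (?m c)))"
    by (intro power_int_increasing) auto
  also have "\<dots> \<le> max (real p powi (int (?m b) - int (?m a))) (real p powi (int (?m d) - int (?m c)))"
    by (auto simp: max_def)
  finally show ?thesis
    using x(2,3) y(2,3) nz unfolding xy
    by (subst padic_abs_frac) (simp_all add: x(1) y(1) padic_abs_frac)
qed (auto simp: max_def)

lemma padic_abs_triangle: "padic_abs p (x + y) \<le> padic_abs p x + padic_abs p y"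
  using padic_abs_add[of x y] padic_abs_nonneg[of x] padic_abs_nonneg[of y] by linarith

lemma padic_abs_diff_le: "\<bar>padic_abs p x - padic_abs p y\<bar> \<le> padic_abs p (x - y)"
  using padic_abs_triangle[of "x - y" y] padic_abs_triangle[of "y - x" x]
    padic_abs_minus_commute[of x y] by simp

lemma padic_null_le:
  assumes "f \<longlonglongrightarrow> 0" "\<And>n. padic_abs p (X n) \<le> f n"
  shows "padic_null p X"
  unfolding padic_null_def
  by (rule tendsto_sandwich[OF _ _ tendsto_const assms(1)]) (simp_all add: assms(2))

lemma padic_null_add:
  "padic_null p X \<Longrightarrow> padic_null p Y \<Longrightarrow> padic_null p (\<lambda>n. X n + Y n)"
  by (rule padic_null_le[of "\<lambda>n. padic_abs p (X n) + padic_abs p (Y n)"])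
     (auto simp: padic_null_def padic_abs_triangle intro: tendsto_eq_intros)

lemma padic_null_minus: "padic_null p X \<Longrightarrow> padic_null p (\<lambda>n. - X n)"
  by (simp add: padic_null_def)

lemma padic_Cauchy_Cauchy:
  assumes "padic_Cauchy p X"
  shows "Cauchy (\<lambda>n. padic_abs p (X n))"
  unfolding Cauchy_def dist_real_def
  using assms padic_abs_diff_le unfolding padic_Cauchy_def by (meson le_less_trans)

lemma padic_Cauchy_convergent: "padic_Cauchy p X \<Longrightarrow> convergent (\<lambda>n. padic_abs p (X n))"
  by (simp add: padic_Cauchy_Cauchy real_Cauchy_convergent)

lemma padic_Cauchy_bounded:
  assumes "padic_Cauchy p X"
  obtains K where "K > 0" "\<And>n. padic_abs p (X n) \<le> K"
proof -
  have "Bseq (\<lambda>n. padic_abs p (X n))"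
    using padic_Cauchy_convergent[OF assms] by (rule convergent_imp_Bseq)
  then show ?thesis using that by (auto simp: Bseq_def)
qed

lemma padic_Cauchy_const: "padic_Cauchy p (\<lambda>_. c)"
  by (simp add: padic_Cauchy_def)

lemma padic_Cauchy_minus: "padic_Cauchy p X \<Longrightarrow> padic_Cauchy p (\<lambda>n. - X n)"
proof -
  have "padic_abs p (- X m - - X n) = padic_abs p (X m - X n)" for m n
    using padic_abs_minus[of "X m - X n"] by simp
  then show "padic_Cauchy p X \<Longrightarrow> padic_Cauchy p (\<lambda>n. - X n)"
    unfolding padic_Cauchy_def by simp
qed

lemma padic_Cauchy_add:
  assumes "padic_Cauchy p X" "padic_Cauchy p Y"
  shows "padic_Cauchy p (\<lambda>n. X n + Y n)"
  unfolding padic_Cauchy_def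
proof (intro allI impI)
  fix e :: real assume "e > 0"
  then obtain N M where N: "\<And>m n. m \<ge> N \<Longrightarrow> n \<ge> N \<Longrightarrow> padic_abs p (X m - X n) < e"
    and M: "\<And>m n. m \<ge> M \<Longrightarrow> n \<ge> M \<Longrightarrow> padic_abs p (Y m - Y n) < e"
    using assms unfolding padic_Cauchy_def by metis
  have "padic_abs p (X m + Y m - (X n + Y n)) < e" if "m \<ge> max N M" "n \<ge> max N M" for m n
    using padic_abs_add[of "X m - X n" "Y m - Y n"] N[of m n] M[of m n] that
    by (simp add: algebra_simps)
  then show "\<exists>K. \<forall>m\<ge>K. \<forall>n\<ge>K. padic_abs p (X m + Y m - (X n + Y n)) < e" by blast
qed

lemma padic_Cauchy_mult:
  assumes "padic_Cauchy p X" "padic_Cauchy p Y"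
  shows "padic_Cauchy p (\<lambda>n. X n * Y n)"
  unfolding padic_Cauchy_def
proof (intro allI impI)
  fix e :: real assume e: "e > 0"
  obtain K where K: "K > 0" "\<And>n. padic_abs p (X n) \<le> K"
    using padic_Cauchy_bounded[OF assms(1)] by blast
  obtain L where L: "L > 0" "\<And>n. padic_abs p (Y n) \<le> L"
    using padic_Cauchy_bounded[OF assms(2)] by blast
  have "e / L > 0" "e / K > 0" using e K L by auto
  then obtain N M where N: "\<And>m n. m \<ge> N \<Longrightarrow> n \<ge> N \<Longrightarrow> padic_abs p (X m - X n) < e / L"
    and M: "\<And>m n. m \<ge> M \<Longrightarrow> n \<ge> M \<Longrightarrow> padic_abs p (Y m - Y n) < e / K"
    using assms unfolding padic_Cauchy_def by metis
  have "padic_abs p (X m * Y m - X n * Y n) < e" if "m \<ge> max N M" "n \<ge> max N M" for m n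
  proof -
    have eq: "X m * Y m - X n * Y n = X m * (Y m - Y n) + (X m - X n) * Y n"
      by (simp add: algebra_simps)
    have "padic_abs p (X m) * padic_abs p (Y m - Y n) \<le> K * padic_abs p (Y m - Y n)"
      using K by (intro mult_right_mono) auto
    also have "\<dots> < K * (e / K)" using M[of m n] that K by (intro mult_strict_left_mono) auto
    finally have 1: "padic_abs p (X m * (Y m - Y n)) < e" using K by (simp add: padic_abs_mult)
    have "padic_abs p (X m - X n) * padic_abs p (Y n) \<le> padic_abs p (X m - X n) * L"
      using L by (intro mult_left_mono) auto
    also have "\<dots> < e / L * L" using N[of m n] that L by (intro mult_strict_right_mono) auto
    finally have 2: "padic_abs p ((X m - X n) * Y n) < e" using L by (simp add: padic_abs_mult)
    show ?thesis
      unfolding eq using padic_abs_add[of "X m * (Y m - Y n)" "(X m - X n) * Y n"] 1 2 by linarith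
  qed
  then show "\<exists>K. \<forall>m\<ge>K. \<forall>n\<ge>K. padic_abs p (X m * Y m - X n * Y n) < e" by blast
qed

lemma padic_null_mult:
  assumes "padic_Cauchy p X" "padic_null p Y"
  shows "padic_null p (\<lambda>n. X n * Y n)"
proof -
  obtain K where K: "K > 0" "\<And>n. padic_abs p (X n) \<le> K"
    using padic_Cauchy_bounded[OF assms(1)] by blast
  show ?thesis
  proof (rule padic_null_le)
    show "(\<lambda>n. K * padic_abs p (Y n)) \<longlonglongrightarrow> 0"
      using assms(2) unfolding padic_null_def by (intro tendsto_mult_right_zero)
    show "padic_abs p (X n * Y n) \<le> K * padic_abs p (Y n)" for n
      unfolding padic_abs_mult using K by (intro mult_right_mono) auto
  qed
qed

lemma padic_not_null:
  assumes "padic_Cauchy p X" "\<not> padic_null p X"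
  obtains c N where "c > 0" "\<And>n. n \<ge> N \<Longrightarrow> padic_abs p (X n) > c"
proof -
  obtain L where L: "(\<lambda>n. padic_abs p (X n)) \<longlonglongrightarrow> L"
    using padic_Cauchy_convergent[OF assms(1)] unfolding convergent_def by blast
  have "L \<ge> 0" by (rule tendsto_lowerbound[OF L]) auto
  moreover have "L \<noteq> 0" using assms(2) L unfolding padic_null_def by auto
  ultimately have "L > 0" by simp
  then have "eventually (\<lambda>n. padic_abs p (X n) > L / 2) sequentially"
    by (intro order_tendstoD(1)[OF L]) simp
  then show ?thesis using that[of "L / 2"] \<open>L > 0\<close> unfolding eventually_sequentially by auto
qed

lemma padic_inverse_diff:
  assumes "c > 0" "padic_abs p x > c" "padic_abs p y > c" "padic_abs p (x - y) < e * (c * c)"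
  shows "padic_abs p (inverse x - inverse y) < e"
proof -
  have nz: "x \<noteq> 0" "y \<noteq> 0" using assms by auto
  then have "inverse x - inverse y = (y - x) * (inverse x * inverse y)"
    by (simp add: field_simps)
  then have eq: "padic_abs p (inverse x - inverse y) =
      padic_abs p (x - y) / (padic_abs p x * padic_abs p y)"
    using padic_abs_minus_commute[of y x]
    by (simp add: padic_abs_mult padic_abs_inverse divide_inverse)
  have "c * c \<le> padic_abs p x * padic_abs p y"
    using assms by (intro mult_mono) auto
  then have "padic_abs p (x - y) / (padic_abs p x * padic_abs p y) \<le> padic_abs p (x - y) / (c * c)"
    using assms(1) by (intro divide_left_mono) (auto intro!: mult_pos_pos padic_abs_pos nz)
  also have "\<dots> < e" using assms(1,4) by (simp add: pos_divide_less_eq)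
  finally show ?thesis unfolding eq .
qed

lemma padic_Cauchy_inverse:
  assumes "padic_Cauchy p X" "\<not> padic_null p X"
  shows "padic_Cauchy p (\<lambda>n. inverse (X n))"
  unfolding padic_Cauchy_def
proof (intro allI impI)
  fix e :: real assume e: "e > 0"
  obtain c N where c: "c > 0" "\<And>n. n \<ge> N \<Longrightarrow> padic_abs p (X n) > c"
    using padic_not_null[OF assms] by blast
  have "e * (c * c) > 0" using e c by simp
  then obtain M where M: "\<And>m n. m \<ge> M \<Longrightarrow> n \<ge> M \<Longrightarrow> padic_abs p (X m - X n) < e * (c * c)"
    using assms(1) unfolding padic_Cauchy_def by metis
  have "padic_abs p (inverse (X m) - inverse (X n)) < e" if "m \<ge> max N M" "n \<ge> max N M" for m n
    by (rule padic_inverse_diff[of c]) (use c M that in auto)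
  then show "\<exists>K. \<forall>m\<ge>K. \<forall>n\<ge>K. padic_abs p (inverse (X m) - inverse (X n)) < e" by blast
qed

lemma padic_null_cong:
  assumes "padic_null p (\<lambda>n. X n - Y n)"
  shows "padic_null p X \<longleftrightarrow> padic_null p Y"
proof
  assume "padic_null p X"
  from padic_null_add[OF this padic_null_minus[OF assms]] show "padic_null p Y" by simp
next
  assume "padic_null p Y"
  from padic_null_add[OF assms this] show "padic_null p X" by simp
qed

lemma padic_null_inverse_diff:
  assumes X: "padic_Cauchy p X" "\<not> padic_null p X" and Y: "padic_Cauchy p Y" "\<not> padic_null p Y"
    and XY: "padic_null p (\<lambda>n. X n - Y n)"
  shows "padic_null p (\<lambda>n. inverse (X n) - inverse (Y n))"
proof -
  obtain c N where c: "c > 0" "\<And>n. n \<ge> N \<Longrightarrow> padic_abs p (X n) > c"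
    using padic_not_null[OF X] by blast
  obtain d M where d: "d > 0" "\<And>n. n \<ge> M \<Longrightarrow> padic_abs p (Y n) > d"
    using padic_not_null[OF Y] by blast
  have "padic_null p (\<lambda>n. (inverse (X n) * inverse (Y n)) * (X n - Y n))"
    by (intro padic_null_mult padic_Cauchy_mult padic_Cauchy_inverse X Y XY)
  then have "padic_null p (\<lambda>n. - ((inverse (X n) * inverse (Y n)) * (X n - Y n)))"
    by (rule padic_null_minus)
  moreover have "- ((inverse (X n) * inverse (Y n)) * (X n - Y n)) = inverse (X n) - inverse (Y n)"
    if "n \<ge> max N M" for n
  proof -
    have "X n \<noteq> 0" "Y n \<noteq> 0" using c(1) c(2)[of n] d(1) d(2)[of n] that by auto
    then show ?thesis by (simp add: field_simps)
  qed
  then have "eventually (\<lambda>n. padic_abs p (- ((inverse (X n) * inverse (Y n)) * (X n - Y n))) =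
      padic_abs p (inverse (X n) - inverse (Y n))) sequentially"
    by (intro eventually_sequentiallyI[of "max N M"]) simp
  ultimately show ?thesis
    unfolding padic_null_def by (rule Lim_transform_eventually)
qed

lemma padic_lim_cong:
  assumes "padic_Cauchy p X" "padic_null p (\<lambda>n. X n - Y n)"
  shows "lim (\<lambda>n. padic_abs p (X n)) = lim (\<lambda>n. padic_abs p (Y n))"
proof -
  have X: "(\<lambda>n. padic_abs p (X n)) \<longlonglongrightarrow> lim (\<lambda>n. padic_abs p (X n))"
    using padic_Cauchy_convergent[OF assms(1)] by (simp add: convergent_LIMSEQ_iff)
  have "(\<lambda>n. padic_abs p (Y n) - padic_abs p (X n)) \<longlonglongrightarrow> 0"
    by (rule Lim_null_comparison[OF _ assms(2)[unfolded padic_null_def]])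
       (auto simp: padic_abs_diff_le padic_abs_minus_commute[of "X _"])
  from tendsto_add[OF this X] have "(\<lambda>n. padic_abs p (Y n)) \<longlonglongrightarrow> lim (\<lambda>n. padic_abs p (X n))"
    by simp
  then show ?thesis by (rule limI[symmetric])
qed

end


section \<open>The field of \<open>p\<close>-adic numbers\<close>

text \<open>
  The type \<open>'p padic\<close> is the completion of the rationals for the \<open>p\<close>-adic absolute value, where
  \<open>p = CARD('p)\<close>. The type \<open>'p\<close> only carries the prime number \<open>p\<close>.
\<close>

typedef (overloaded) 'p padic_seq = "{X. padic_Cauchy CARD('p::prime_card) X}"
  using padic_Cauchy_const[OF prime_card] by blast

setup_lifting type_definition_padic_seq

instantiation padic_seq :: (prime_card) comm_ring_1
begin

lift_definition zero_padic_seq :: "'a padic_seq" is "\<lambda>n. 0"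
  by (rule padic_Cauchy_const[OF prime_card])

lift_definition one_padic_seq :: "'a padic_seq" is "\<lambda>n. 1"
  by (rule padic_Cauchy_const[OF prime_card])

lift_definition plus_padic_seq :: "'a padic_seq \<Rightarrow> 'a padic_seq \<Rightarrow> 'a padic_seq" is "\<lambda>X Y n. X n + Y n"
  by (rule padic_Cauchy_add[OF prime_card])

lift_definition uminus_padic_seq :: "'a padic_seq \<Rightarrow> 'a padic_seq" is "\<lambda>X n. - X n"
  by (rule padic_Cauchy_minus[OF prime_card])

lift_definition minus_padic_seq :: "'a padic_seq \<Rightarrow> 'a padic_seq \<Rightarrow> 'a padic_seq" is "\<lambda>X Y n. X n - Y n"
  using padic_Cauchy_add[OF prime_card _ padic_Cauchy_minus[OF prime_card]] by simp

lift_definition times_padic_seq :: "'a padic_seq \<Rightarrow> 'a padic_seq \<Rightarrow> 'a padic_seq" is "\<lambda>X Y n. X n * Y n"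
  by (rule padic_Cauchy_mult[OF prime_card])

instance
  by standard (transfer; simp add: fun_eq_iff algebra_simps)+

end

lift_definition padic_seq_null :: "'p::prime_card padic_seq \<Rightarrow> bool" is "padic_null CARD('p)" .

lift_definition padic_seq_inverse :: "'p::prime_card padic_seq \<Rightarrow> 'p padic_seq" is
  "\<lambda>X. if padic_null CARD('p) X then (\<lambda>n. 0) else (\<lambda>n. inverse (X n))"
  by (simp add: padic_Cauchy_const[OF prime_card] padic_Cauchy_inverse[OF prime_card])

lift_definition padic_seq_norm :: "'p::prime_card padic_seq \<Rightarrow> real" is
  "\<lambda>X. lim (\<lambda>n. padic_abs CARD('p) (X n))" .

lemma padic_seq_null_0: "padic_seq_null 0"
  by transfer (simp add: padic_null_def)

lemma padic_seq_null_1: "\<not> padic_seq_null 1"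
  by transfer (simp add: padic_null_def prime_card LIMSEQ_const_iff)

lemma padic_seq_null_add: "padic_seq_null x \<Longrightarrow> padic_seq_null y \<Longrightarrow> padic_seq_null (x + y)"
  by transfer (rule padic_null_add[OF prime_card])

lemma padic_seq_null_minus: "padic_seq_null x \<Longrightarrow> padic_seq_null (- x)"
  by transfer (rule padic_null_minus[OF prime_card])

lemma padic_seq_null_mult: "padic_seq_null y \<Longrightarrow> padic_seq_null (x * y)"
  by transfer (rule padic_null_mult[OF prime_card])

lemma padic_seq_null_cong: "padic_seq_null (x - y) \<Longrightarrow> padic_seq_null x \<longleftrightarrow> padic_seq_null y"
  by transfer (rule padic_null_cong[OF prime_card])

lemma padic_seq_norm_cong: "padic_seq_null (x - y) \<Longrightarrow> padic_seq_norm x = padic_seq_norm y"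
  by transfer (rule padic_lim_cong[OF prime_card])

lemma padic_seq_null_inverse_diff:
  "padic_seq_null (x - y) \<Longrightarrow> padic_seq_null (padic_seq_inverse x - padic_seq_inverse y)"
proof (cases "padic_seq_null x")
  case True
  assume "padic_seq_null (x - y)"
  with True have "padic_seq_null y" by (simp add: padic_seq_null_cong)
  with True show ?thesis by transfer (simp add: padic_null_def)
next
  case False
  assume *: "padic_seq_null (x - y)"
  with False have "\<not> padic_seq_null y" by (simp add: padic_seq_null_cong)
  with * False show ?thesis
    by transfer (simp add: padic_null_inverse_diff[OF prime_card])
qed

lemma padic_seq_inverse_0: "padic_seq_inverse 0 = 0"
  by transfer (simp add: padic_null_def)

lemma padic_seq_inverse_mult:
  "\<not> padic_seq_null x \<Longrightarrow> padic_seq_null (padic_seq_inverse x * x - 1)"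
proof transfer
  fix X :: "nat \<Rightarrow> rat"
  assume C: "padic_Cauchy CARD('a) X" and nn: "\<not> padic_null CARD('a) X"
  obtain c N where c: "c > 0" "\<And>n. n \<ge> N \<Longrightarrow> padic_abs CARD('a) (X n) > c"
    using padic_not_null[OF prime_card C nn] by blast
  have "eventually (\<lambda>n. 0 = padic_abs CARD('a) (inverse (X n) * X n - 1)) sequentially"
  proof (rule eventually_sequentiallyI[of N])
    fix n assume "n \<ge> N"
    with c have "X n \<noteq> 0" by fastforce
    then show "0 = padic_abs CARD('a) (inverse (X n) * X n - 1)" by simp
  qed
  then have "padic_null CARD('a) (\<lambda>n. inverse (X n) * X n - 1)"
    unfolding padic_null_def by (rule Lim_transform_eventually[OF tendsto_const])
  with nn show "padic_null CARD('a)
      (\<lambda>n. (if padic_null CARD('a) X then \<lambda>n. 0 else (\<lambda>n. inverse (X n))) n * X n - 1)"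
    by simp
qed

definition padic_rel :: "'p::prime_card padic_seq \<Rightarrow> 'p padic_seq \<Rightarrow> bool" where
  "padic_rel x y \<longleftrightarrow> padic_seq_null (x - y)"

lemma padic_rel_refl: "padic_rel x x"
  by (simp add: padic_rel_def padic_seq_null_0)

quotient_type (overloaded) 'p padic = "'p::prime_card padic_seq" / padic_rel
proof (rule equivpI)
  show "reflp (padic_rel :: 'p padic_seq \<Rightarrow> _)"
    by (rule reflpI) (rule padic_rel_refl)
  show "symp (padic_rel :: 'p padic_seq \<Rightarrow> _)"
    by (rule sympI) (auto simp: padic_rel_def dest: padic_seq_null_minus)
  show "transp (padic_rel :: 'p padic_seq \<Rightarrow> _)"
    by (rule transpI) (auto simp: padic_rel_def dest: padic_seq_null_add)
qed

instantiation padic :: (prime_card) field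
begin

lift_definition zero_padic :: "'a padic" is 0 .

lift_definition one_padic :: "'a padic" is 1 .

lift_definition plus_padic :: "'a padic \<Rightarrow> 'a padic \<Rightarrow> 'a padic" is "(+)"
  unfolding padic_rel_def add_diff_add by (rule padic_seq_null_add)

lift_definition uminus_padic :: "'a padic \<Rightarrow> 'a padic" is uminus
  unfolding padic_rel_def minus_diff_minus by (rule padic_seq_null_minus)

lift_definition minus_padic :: "'a padic \<Rightarrow> 'a padic \<Rightarrow> 'a padic" is "(-)"
  unfolding padic_rel_def diff_diff_add[symmetric]
  by (metis (no_types, opaque_lifting) add_diff_add diff_conv_add_uminus minus_diff_minus
      padic_seq_null_add padic_seq_null_minus)

lift_definition times_padic :: "'a padic \<Rightarrow> 'a padic \<Rightarrow> 'a padic" is "(*)"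
proof -
  fix x x' y y' :: "'a padic_seq"
  assume "padic_rel x x'" "padic_rel y y'"
  then have "padic_seq_null (x * (y - y') + y' * (x - x'))"
    unfolding padic_rel_def by (intro padic_seq_null_add padic_seq_null_mult)
  then show "padic_rel (x * y) (x' * y')"
    by (simp add: padic_rel_def algebra_simps)
qed

lift_definition inverse_padic :: "'a padic \<Rightarrow> 'a padic" is padic_seq_inverse
  unfolding padic_rel_def by (rule padic_seq_null_inverse_diff)

definition divide_padic :: "'a padic \<Rightarrow> 'a padic \<Rightarrow> 'a padic" where
  "divide_padic x y = x * inverse y"

instance
proof
  fix a b c :: "'a padic"
  show "a + b + c = a + (b + c)"
    by transfer (simp add: add.assoc padic_rel_refl)
  show "a + b = b + a"
    by transfer (simp add: add.commute padic_rel_refl)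
  show "0 + a = a"
    by transfer (simp add: padic_rel_refl)
  show "- a + a = 0"
    by transfer (simp add: padic_rel_refl)
  show "a - b = a + - b"
    by transfer (simp add: padic_rel_refl)
  show "a * b * c = a * (b * c)"
    by transfer (simp add: mult.assoc padic_rel_refl)
  show "a * b = b * a"
    by transfer (simp add: mult.commute padic_rel_refl)
  show "1 * a = a"
    by transfer (simp add: padic_rel_refl)
  show "(a + b) * c = a * c + b * c"
    by transfer (simp add: distrib_right padic_rel_refl)
  show "(0::'a padic) \<noteq> 1"
    by transfer (use padic_seq_null_minus[of "- 1"] padic_seq_null_1 in \<open>auto simp: padic_rel_def\<close>)
  show "a div b = a * inverse b"
    by (rule divide_padic_def)
  show "inverse (0::'a padic) = 0"
    by transfer (simp add: padic_seq_inverse_0 padic_rel_refl)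
  show "inverse a * a = 1" if "a \<noteq> 0"
    using that by transfer (simp add: padic_rel_def padic_seq_inverse_mult)
qed

end

lift_definition padic_norm :: "'p::prime_card padic \<Rightarrow> real" is padic_seq_norm
  unfolding padic_rel_def by (rule padic_seq_norm_cong)

definition padic_integers :: "'p::prime_card padic set" where
  "padic_integers = {x. padic_norm x \<le> 1}"

definition padic_maximal_ideal :: "'p::prime_card padic set" where
  "padic_maximal_ideal = (\<lambda>x. of_nat CARD('p) * x) ` padic_integers"


section \<open>Metrics on \<open>\<rat>\<^sub>p\<^sup>d\<close> and their linear isometries\<close>

text \<open>Coordinates and matrix entries are numbered from \<open>0\<close> to \<open>d - 1\<close>.\<close>

definition std_dist :: "nat \<Rightarrow> 'p::prime_card padic vec \<Rightarrow> 'p padic vec \<Rightarrow> real" where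
  "std_dist d x y = Max ((\<lambda>l. padic_norm (x $ l - y $ l)) ` {..<d})"

definition deformed_dist ::
  "nat \<Rightarrow> (nat \<Rightarrow> real) \<Rightarrow> 'p::prime_card padic vec \<Rightarrow> 'p padic vec \<Rightarrow> real" where
  "deformed_dist d q x y = Max ((\<lambda>l. q l * padic_norm (x $ l - y $ l)) ` {..<d})"

text \<open>Linear maps are identified with their matrices in the standard basis.\<close>

definition isometry_group ::
  "nat \<Rightarrow> ('p::prime_card padic vec \<Rightarrow> 'p padic vec \<Rightarrow> real) \<Rightarrow> 'p padic mat monoid" where
  "isometry_group d \<delta> =
     \<lparr>carrier = {A \<in> carrier_mat d d.
        \<forall>x\<in>carrier_vec d. \<forall>y\<in>carrier_vec d. \<delta> (A *\<^sub>v x) (A *\<^sub>v y) = \<delta> x y},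
      mult = (*), one = 1\<^sub>m d\<rparr>"

abbreviation orthogonal_group :: "nat \<Rightarrow> 'p::prime_card padic mat monoid" where
  "orthogonal_group d \<equiv> isometry_group d (std_dist d)"

end

theory Submission
  imports Defs "Jordan_Normal_Form.Determinant"
begin

text \<open>
  Write \<open>N x = max\<^sub>l q\<^sub>l |x\<^sub>l|\<close>, so that the deformed distance is \<open>N (x - y)\<close>, and the standard one
  is the case \<open>q = 1\<close>. Since \<open>N\<close> is an ultrametric norm, a matrix \<open>A\<close> does not expand \<open>N\<close> exactly
  when it does not expand it on the basis vectors, that is, when \<open>q\<^sub>a |A\<^sub>a\<^sub>b| \<le> q\<^sub>b\<close> for all entries
  (\<open>nonexpanding_iff\<close>). An isometry is an invertible matrix such that it and its inverse satisfy
  these bounds (\<open>isometry_iff_inverse\<close>).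

  Let \<open>A\<close> be an isometry of \<open>N\<close>. As \<open>q\<^sub>b / q\<^sub>a < p\<close> and the norm takes no value strictly
  between \<open>1\<close> and \<open>p\<close>, the bounds for \<open>A\<close> and for its inverse say that both matrices are integral,
  so \<open>A\<close> preserves the standard norm; and where \<open>q\<^sub>b < q\<^sub>a\<close> they say \<open>|A\<^sub>a\<^sub>b| < 1\<close>, which is the
  triangularity modulo \<open>p\<close>.

  Conversely, let \<open>A\<close> preserve the standard norm and be block triangular modulo \<open>p\<close>. The
  difficulty is that the bounds are also needed for the inverse. Replace the entries with
  \<open>q\<^sub>b < q\<^sub>a\<close>, all of norm at most \<open>1 / p\<close>, by \<open>0\<close>. The change is so small, for the standard norm and
  also for \<open>N\<close>, because all weights exceed \<open>1 / p\<close>, that by the ultrametric inequality it cannot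
  affect whether the matrix is an isometry (\<open>isometry_perturbation\<close>). The new matrix is exactly
  block triangular over the field of \<open>p\<close>-adic numbers, so its inverse is too
  (\<open>inverse_mat_preserves_coordinate_subspace\<close>). Both are integral, which gives the bounds at the
  remaining entries.
\<close>

section \<open>The norm of a \<open>p\<close>-adic number\<close>

lemma padic_Cauchy_LIMSEQ:
  assumes "prime p" "padic_Cauchy p X"
  shows "(\<lambda>n. padic_abs p (X n)) \<longlonglongrightarrow> lim (\<lambda>n. padic_abs p (X n))"
  using padic_Cauchy_convergent[OF assms] by (simp add: convergent_LIMSEQ_iff)

lemma padic_seq_norm_eq_0_iff: "padic_seq_norm x = 0 \<longleftrightarrow> padic_seq_null x"
proof transfer
  fix X assume X: "padic_Cauchy CARD('a) X"
  show "lim (\<lambda>n. padic_abs CARD('a) (X n)) = 0 \<longleftrightarrow> padic_null CARD('a) X"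
    using padic_Cauchy_LIMSEQ[OF prime_card X] unfolding padic_null_def by (metis limI)
qed

lemma padic_seq_norm_nonneg: "padic_seq_norm x \<ge> 0"
proof transfer
  fix X assume X: "padic_Cauchy CARD('a) X"
  show "lim (\<lambda>n. padic_abs CARD('a) (X n)) \<ge> 0"
    by (rule tendsto_lowerbound[OF padic_Cauchy_LIMSEQ[OF prime_card X]])
       (simp_all add: padic_abs_nonneg[OF prime_card])
qed

lemma padic_seq_norm_mult: "padic_seq_norm (x * y) = padic_seq_norm x * padic_seq_norm y"
proof transfer
  fix X Y assume "padic_Cauchy CARD('a) X" "padic_Cauchy CARD('a) Y"
  then show "lim (\<lambda>n. padic_abs CARD('a) (X n * Y n)) =
      lim (\<lambda>n. padic_abs CARD('a) (X n)) * lim (\<lambda>n. padic_abs CARD('a) (Y n))"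
    by (intro limI) (simp add: padic_abs_mult[OF prime_card] tendsto_mult padic_Cauchy_LIMSEQ prime_card)
qed

lemma padic_seq_norm_minus: "padic_seq_norm (- x) = padic_seq_norm x"
  by transfer (simp add: padic_abs_minus[OF prime_card])

lemma padic_seq_norm_add: "padic_seq_norm (x + y) \<le> max (padic_seq_norm x) (padic_seq_norm y)"
proof transfer
  fix X Y assume X: "padic_Cauchy CARD('a) X" and Y: "padic_Cauchy CARD('a) Y"
  show "lim (\<lambda>n. padic_abs CARD('a) (X n + Y n)) \<le>
      max (lim (\<lambda>n. padic_abs CARD('a) (X n))) (lim (\<lambda>n. padic_abs CARD('a) (Y n)))"
  proof (rule LIMSEQ_le)
    show "(\<lambda>n. padic_abs CARD('a) (X n + Y n)) \<longlonglongrightarrow> lim (\<lambda>n. padic_abs CARD('a) (X n + Y n))"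
      by (intro padic_Cauchy_LIMSEQ padic_Cauchy_add prime_card X Y)
    show "(\<lambda>n. max (padic_abs CARD('a) (X n)) (padic_abs CARD('a) (Y n))) \<longlonglongrightarrow>
        max (lim (\<lambda>n. padic_abs CARD('a) (X n))) (lim (\<lambda>n. padic_abs CARD('a) (Y n)))"
      by (intro tendsto_max padic_Cauchy_LIMSEQ prime_card X Y)
  qed (auto intro: padic_abs_add[OF prime_card])
qed

lemma padic_seq_norm_of_nat:
  "padic_seq_norm (of_nat m :: 'p::prime_card padic_seq) = padic_abs CARD('p) (of_nat m)"
proof -
  have "Rep_padic_seq (of_nat m :: 'p padic_seq) = (\<lambda>_. of_nat m)"
    by (induction m) (simp_all add: zero_padic_seq.rep_eq one_padic_seq.rep_eq plus_padic_seq.rep_eq)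
  then show ?thesis
    by (simp add: padic_seq_norm.rep_eq)
qed

text \<open>
  The terms of a Cauchy sequence that does not tend to \<open>0\<close> are eventually so close to each other,
  compared to their size, that the ultrametric inequality makes their absolute values equal; so
  the completion has no new values.
\<close>

lemma padic_seq_norm_values:
  fixes x :: "'p::prime_card padic_seq"
  assumes "\<not> padic_seq_null x"
  shows "\<exists>k::int. padic_seq_norm x = real CARD('p) powi k"
  using assms
proof transfer
  fix X assume X: "padic_Cauchy CARD('p) X" and nn: "\<not> padic_null CARD('p) X"
  obtain c N where c: "c > 0" "\<And>n. n \<ge> N \<Longrightarrow> padic_abs CARD('p) (X n) > c"
    using padic_not_null[OF prime_card X nn] by blast
  obtain M where M: "\<And>m n. m \<ge> M \<Longrightarrow> n \<ge> M \<Longrightarrow> padic_abs CARD('p) (X m - X n) < c"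
    using X c(1) unfolding padic_Cauchy_def by metis
  define K where "K = max N M"
  have const: "padic_abs CARD('p) (X n) = padic_abs CARD('p) (X K)" if "n \<ge> K" for n
  proof -
    have "padic_abs CARD('p) (X n - X K) < c" "padic_abs CARD('p) (X K - X n) < c"
      "padic_abs CARD('p) (X n) > c" "padic_abs CARD('p) (X K) > c"
      using M c(2) that unfolding K_def by auto
    then show ?thesis
      using padic_abs_add[OF prime_card[where 'a = 'p], where x = "X n - X K" and y = "X K"]
        padic_abs_add[OF prime_card[where 'a = 'p], where x = "X K - X n" and y = "X n"] by auto
  qed
  have "lim (\<lambda>n. padic_abs CARD('p) (X n)) = padic_abs CARD('p) (X K)"
    by (intro limI tendsto_eventually eventually_sequentiallyI[of K] const)
  moreover have "X K \<noteq> 0"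
    using c(1) c(2)[of K] unfolding K_def by auto
  ultimately show "\<exists>k::int. lim (\<lambda>n. padic_abs CARD('p) (X n)) = real CARD('p) powi k"
    unfolding padic_abs_def by auto
qed

lemma padic_norm_eq_0_iff [simp]: "padic_norm x = 0 \<longleftrightarrow> x = 0"
  by transfer (simp add: padic_seq_norm_eq_0_iff padic_rel_def)

lemma padic_norm_0 [simp]: "padic_norm 0 = 0"
  by simp

lemma padic_norm_nonneg [simp]: "padic_norm x \<ge> 0"
  by transfer (rule padic_seq_norm_nonneg)

lemma padic_norm_mult: "padic_norm (x * y) = padic_norm x * padic_norm y"
  by transfer (rule padic_seq_norm_mult)

lemma padic_norm_minus [simp]: "padic_norm (- x) = padic_norm x"
  by transfer (rule padic_seq_norm_minus)

lemma padic_norm_minus_commute: "padic_norm (x - y) = padic_norm (y - x)"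
  using padic_norm_minus[of "x - y"] by simp

lemma padic_norm_add: "padic_norm (x + y) \<le> max (padic_norm x) (padic_norm y)"
  by transfer (rule padic_seq_norm_add)

lemma padic_norm_1 [simp]: "padic_norm 1 = 1"
  using padic_norm_mult[of 1 1] padic_norm_eq_0_iff[of 1] by simp

lemma padic_norm_values:
  fixes x :: "'p::prime_card padic"
  shows "x \<noteq> 0 \<Longrightarrow> \<exists>k::int. padic_norm x = real CARD('p) powi k"
  by transfer (simp add: padic_rel_def padic_seq_norm_values)

lemma of_nat_padic_eq: "(of_nat m :: 'p::prime_card padic) = abs_padic (of_nat m)"
  by (induction m) (simp_all add: zero_padic_def one_padic_def plus_padic.abs_eq padic_rel_refl)

lemma padic_norm_prime: "padic_norm (of_nat CARD('p) :: 'p::prime_card padic) = 1 / real CARD('p)"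
proof -
  have pr: "prime CARD('p)"
    by (rule prime_card)
  then have "CARD('p) \<noteq> 0" and nu: "\<not> is_unit (int CARD('p))"
    by (auto simp: not_prime_1)
  then have "multiplicity (int CARD('p)) (int CARD('p)) = 1"
    by (intro multiplicity_self) auto
  then have "padic_abs CARD('p) (of_nat CARD('p)) = 1 / real CARD('p)"
    using padic_abs_frac[OF pr, of "int CARD('p)" 1] \<open>CARD('p) \<noteq> 0\<close>
    by (simp add: power_int_minus field_simps)
  then show ?thesis
    by (simp add: of_nat_padic_eq padic_norm.abs_eq padic_seq_norm_of_nat)
qed

text \<open>
  The values of the norm are \<open>0\<close> and the powers of \<open>p\<close>. This discreteness is why the parameters
  \<open>q\<^sub>l\<close> may vary in \<open>(p\<^sup>-\<^sup>1, 1]\<close> without the isometries leaving the integral matrices.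
\<close>

lemma padic_norm_less_prime:
  fixes x :: "'p::prime_card padic"
  assumes "padic_norm x < real CARD('p)"
  shows "padic_norm x \<le> 1"
proof (cases "x = 0")
  case False
  then obtain k :: int where k: "padic_norm x = real CARD('p) powi k"
    using padic_norm_values by blast
  have p1: "real CARD('p) > 1"
    using prime_gt_1_nat[OF prime_card] by simp
  have "\<not> k \<ge> 1"
    using power_int_increasing[of 1 k "real CARD('p)"] p1 assms k by auto
  then show ?thesis
    using power_int_increasing[of k 0 "real CARD('p)"] p1 k by simp
qed simp

lemma padic_norm_less_1:
  fixes x :: "'p::prime_card padic"
  assumes "padic_norm x < 1"
  shows "padic_norm x \<le> 1 / real CARD('p)"
proof -
  have p0: "real CARD('p) > 0"
    using prime_gt_0_nat[OF prime_card] by simp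
  let ?y = "x / of_nat CARD('p)"
  have nz: "(of_nat CARD('p) :: 'p padic) \<noteq> 0"
    using padic_norm_prime[where 'p = 'p] p0
    by (metis padic_norm_0 divide_eq_0_iff less_irrefl zero_neq_one)
  then have "padic_norm x = padic_norm (of_nat CARD('p) * ?y)"
    by simp
  then have eq: "padic_norm x = padic_norm ?y / real CARD('p)"
    unfolding padic_norm_mult by (simp add: padic_norm_prime)
  with assms p0 have "padic_norm ?y \<le> 1"
    by (intro padic_norm_less_prime) (simp add: field_simps)
  with eq p0 show ?thesis
    by (simp add: divide_right_mono)
qed

lemma padic_maximal_ideal_iff:
  fixes x :: "'p::prime_card padic"
  shows "x \<in> padic_maximal_ideal \<longleftrightarrow> padic_norm x < 1"
proof
  have p1: "real CARD('p) > 1"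
    using prime_gt_1_nat[OF prime_card] by simp
  {
    assume "x \<in> padic_maximal_ideal"
    then obtain y where y: "x = of_nat CARD('p) * y" "padic_norm y \<le> 1"
      by (auto simp: padic_maximal_ideal_def padic_integers_def)
    then have "padic_norm x \<le> 1 / real CARD('p)"
      by (simp add: padic_norm_mult padic_norm_prime divide_right_mono)
    also have "\<dots> < 1"
      using p1 by simp
    finally show "padic_norm x < 1" .
  }
  {
    assume "padic_norm x < 1"
    then have le: "padic_norm x \<le> 1 / real CARD('p)"
      by (rule padic_norm_less_1)
    have nz: "(of_nat CARD('p) :: 'p padic) \<noteq> 0"
      using padic_norm_prime[where 'p = 'p] p1 by fastforce
    then have x: "x = of_nat CARD('p) * (x / of_nat CARD('p))"
      by simp
    then have "padic_norm x = 1 / real CARD('p) * padic_norm (x / of_nat CARD('p))"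
      by (metis padic_norm_mult padic_norm_prime)
    with le p1 have "padic_norm (x / of_nat CARD('p)) \<le> 1"
      by (simp add: field_simps)
    with x show "x \<in> padic_maximal_ideal"
      unfolding padic_maximal_ideal_def padic_integers_def by blast
  }
qed

lemma padic_norm_sum_le:
  assumes "\<And>i. i \<in> I \<Longrightarrow> padic_norm (f i) \<le> c" "0 \<le> c"
  shows "padic_norm (sum f I) \<le> c"
  using assms(1)
proof (induction I rule: infinite_finite_induct)
  case (insert i I)
  then have "padic_norm (f i) \<le> c" "padic_norm (sum f I) \<le> c"
    by auto
  then show ?case
    using insert.hyps padic_norm_add[of "f i" "sum f I"] by simp
qed (simp_all add: assms(2))

lemma padic_norm_sum_less:
  assumes "\<And>i. i \<in> I \<Longrightarrow> padic_norm (f i) < c" "0 < c"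
  shows "padic_norm (sum f I) < c"
  using assms(1)
proof (induction I rule: infinite_finite_induct)
  case (insert i I)
  then have "padic_norm (f i) < c" "padic_norm (sum f I) < c"
    by auto
  then show ?case
    using insert.hyps padic_norm_add[of "f i" "sum f I"] by simp
qed (simp_all add: assms(2))


section \<open>Inverses of matrices over a field\<close>

lemma inverse_mat_exists:
  fixes A :: "'a::field mat"
  assumes A: "A \<in> carrier_mat d d"
    and inj: "\<And>x. x \<in> carrier_vec d \<Longrightarrow> A *\<^sub>v x = 0\<^sub>v d \<Longrightarrow> x = 0\<^sub>v d"
  obtains B where "B \<in> carrier_mat d d" "A * B = 1\<^sub>m d" "B * A = 1\<^sub>m d"
proof -
  have "det A \<noteq> 0"
    using det_0_iff_vec_prod_zero_field[OF A] inj by blast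
  from det_non_zero_imp_unit[OF A this, of undefined] that show ?thesis
    unfolding Units_def by (auto simp: ring_mat_def)
qed

lemma mult_mat_vec_index_sum:
  assumes "A \<in> carrier_mat d d" "x \<in> carrier_vec d" "a < d"
  shows "(A *\<^sub>v x) $ a = (\<Sum>b<d. A $$ (a, b) * x $ b)"
  using assms by (auto simp: scalar_prod_def atLeast0LessThan intro!: sum.cong)

lemma mult_mat_unit_vec:
  fixes A :: "'a::semiring_1 mat"
  assumes "A \<in> carrier_mat d d" "a < d" "b < d"
  shows "(A *\<^sub>v unit_vec d b) $ a = A $$ (a, b)"
  using assms by simp

text \<open>
  The hypothesis says that \<open>A\<close> maps the coordinate subspace spanned by \<open>S\<close> into itself. Being
  injective, it maps this finite-dimensional subspace onto itself, so the inverse preserves it too.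
  To see surjectivity by square matrices, replace the columns outside \<open>S\<close> by those of the
  identity: the result \<open>C\<close> is still injective, hence surjective, and agrees with \<open>A\<close> on the
  subspace, and \<open>C x\<close> lies in the subspace only if \<open>x\<close> does.
\<close>

lemma inverse_mat_preserves_coordinate_subspace:
  fixes A :: "'a::field mat"
  assumes A: "A \<in> carrier_mat d d" and B: "B \<in> carrier_mat d d" and BA: "B * A = 1\<^sub>m d"
    and zero: "\<And>a b. a < d \<Longrightarrow> b < d \<Longrightarrow> a \<notin> S \<Longrightarrow> b \<in> S \<Longrightarrow> A $$ (a, b) = 0"
    and ab: "a < d" "b < d" "a \<notin> S" "b \<in> S"
  shows "B $$ (a, b) = 0"
proof -
  define C where "C = mat d d (\<lambda>(i, j). if j \<in> S then A $$ (i, j) else 1\<^sub>m d $$ (i, j))"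
  have C: "C \<in> carrier_mat d d"
    by (simp add: C_def)
  have off: "(C *\<^sub>v x) $ i = x $ i" if "x \<in> carrier_vec d" "i < d" "i \<notin> S" for x i
  proof -
    have "(C *\<^sub>v x) $ i = (\<Sum>j<d. if j = i then x $ j else 0)"
      unfolding mult_mat_vec_index_sum[OF C that(1,2)]
      by (rule sum.cong) (use that zero in \<open>auto simp: C_def\<close>)
    also have "\<dots> = x $ i"
      using that(2) by simp
    finally show ?thesis .
  qed
  have on: "C *\<^sub>v x = A *\<^sub>v x" if x: "x \<in> carrier_vec d" "\<And>i. i < d \<Longrightarrow> i \<notin> S \<Longrightarrow> x $ i = 0" for x
  proof (rule eq_vecI)
    fix i assume "i < dim_vec (A *\<^sub>v x)"
    then have i: "i < d"
      using A by simp
    show "(C *\<^sub>v x) $ i = (A *\<^sub>v x) $ i"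
      unfolding mult_mat_vec_index_sum[OF C x(1) i] mult_mat_vec_index_sum[OF A x(1) i]
      by (rule sum.cong) (use x(2) i in \<open>auto simp: C_def\<close>)
  qed (use A C in simp)
  have BAx: "B *\<^sub>v (A *\<^sub>v x) = x" if "x \<in> carrier_vec d" for x
    using that assoc_mult_mat_vec[OF B A that] BA by simp
  have "x = 0\<^sub>v d" if x: "x \<in> carrier_vec d" "C *\<^sub>v x = 0\<^sub>v d" for x
  proof -
    have "A *\<^sub>v x = 0\<^sub>v d"
      using on[OF x(1)] off[OF x(1)] x(2) by simp
    then show ?thesis
      using BAx[OF x(1)] B by auto
  qed
  then obtain C' where C': "C' \<in> carrier_mat d d" "C * C' = 1\<^sub>m d"
    using inverse_mat_exists[OF C] by blast
  define x where "x = C' *\<^sub>v unit_vec d b"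
  have x: "x \<in> carrier_vec d"
    using C' by (simp add: x_def)
  have Cx: "C *\<^sub>v x = unit_vec d b"
    using assoc_mult_mat_vec[OF C C'(1), of "unit_vec d b"] C'(2) by (simp add: x_def)
  have x0: "x $ i = 0" if "i < d" "i \<notin> S" for i
    using off[OF x that] that ab(2,4) unfolding Cx by (auto split: if_splits)
  have "B *\<^sub>v unit_vec d b = x"
    using BAx[OF x] on[OF x x0] Cx by simp
  then show ?thesis
    using mult_mat_unit_vec[OF B ab(1,2)] x0[OF ab(1,3)] by simp
qed


section \<open>Linear isometries of a weighted maximum norm\<close>

definition weighted_norm :: "nat \<Rightarrow> (nat \<Rightarrow> real) \<Rightarrow> 'p::prime_card padic vec \<Rightarrow> real" where
  "weighted_norm d q x = Max ((\<lambda>l. q l * padic_norm (x $ l)) ` {..<d})"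

lemma deformed_dist_eq_weighted_norm:
  assumes "x \<in> carrier_vec d" "y \<in> carrier_vec d"
  shows "deformed_dist d q x y = weighted_norm d q (x - y)"
  unfolding deformed_dist_def weighted_norm_def
  by (intro arg_cong[where f = Max] image_cong) (use assms in auto)

lemma std_dist_eq_deformed_dist: "std_dist d = deformed_dist d (\<lambda>_. 1)"
  by (simp add: fun_eq_iff std_dist_def deformed_dist_def)

context
  fixes d :: nat and q :: "nat \<Rightarrow> real"
  assumes d: "0 < d" and pos: "\<forall>l<d. 0 < q l"
begin

lemma weighted_norm_le_iff:
  "weighted_norm d q x \<le> c \<longleftrightarrow> (\<forall>l<d. q l * padic_norm (x $ l) \<le> c)"
  unfolding weighted_norm_def using d by (subst Max_le_iff) auto

lemma weighted_norm_less_iff: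
  "weighted_norm d q x < c \<longleftrightarrow> (\<forall>l<d. q l * padic_norm (x $ l) < c)"
  unfolding weighted_norm_def using d by (subst Max_less_iff) auto

lemma weighted_norm_ge: "l < d \<Longrightarrow> q l * padic_norm (x $ l) \<le> weighted_norm d q x"
  using weighted_norm_le_iff[of x "weighted_norm d q x"] by simp

lemma weighted_norm_nonneg: "0 \<le> weighted_norm d q x"
  using weighted_norm_ge[OF d, of x] pos[rule_format, OF d]
  by (meson mult_nonneg_nonneg less_imp_le order_trans padic_norm_nonneg)

lemma weighted_norm_0 [simp]: "weighted_norm d q (0\<^sub>v d) = 0"
proof (rule order_antisym)
  show "weighted_norm d q (0\<^sub>v d) \<le> 0"
    by (simp add: weighted_norm_le_iff)
qed (rule weighted_norm_nonneg)

lemma weighted_norm_pos: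
  assumes "x \<in> carrier_vec d" "x \<noteq> 0\<^sub>v d"
  shows "0 < weighted_norm d q x"
proof -
  obtain l where "l < d" "x $ l \<noteq> 0"
    using assms by (metis carrier_vecD eq_vecI index_zero_vec)
  then have "0 < q l * padic_norm (x $ l)"
    using pos padic_norm_nonneg[of "x $ l"] by (simp add: order_less_le)
  then show ?thesis
    using weighted_norm_ge[OF \<open>l < d\<close>, of x] by linarith
qed

lemma weighted_norm_le_max:
  assumes "x \<in> carrier_vec d" "y \<in> carrier_vec d"
  shows "weighted_norm d q x \<le> max (weighted_norm d q (x - y)) (weighted_norm d q y)"
  unfolding weighted_norm_le_iff
proof (intro allI impI)
  fix l assume l: "l < d"
  have "padic_norm (x $ l) \<le> max (padic_norm ((x - y) $ l)) (padic_norm (y $ l))"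
    using padic_norm_add[of "x $ l - y $ l" "y $ l"] assms l by simp
  then have "q l * padic_norm (x $ l) \<le>
      max (q l * padic_norm ((x - y) $ l)) (q l * padic_norm (y $ l))"
    using pos[rule_format, OF l] by (simp add: le_max_iff_disj)
  then show "q l * padic_norm (x $ l) \<le> max (weighted_norm d q (x - y)) (weighted_norm d q y)"
    using weighted_norm_ge[OF l, of "x - y"] weighted_norm_ge[OF l, of y] by linarith
qed

lemma weighted_norm_minus_commute:
  assumes "x \<in> carrier_vec d" "y \<in> carrier_vec d"
  shows "weighted_norm d q (x - y) = weighted_norm d q (y - x)"
  unfolding weighted_norm_def
  by (intro arg_cong[where f = Max] image_cong)
     (use assms in \<open>auto simp: padic_norm_minus_commute\<close>)

lemma weighted_norm_isosceles:
  assumes "x \<in> carrier_vec d" "y \<in> carrier_vec d" "weighted_norm d q (x - y) < weighted_norm d q y"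
  shows "weighted_norm d q x = weighted_norm d q y"
  using weighted_norm_le_max[OF assms(1,2)] weighted_norm_le_max[OF assms(2,1)] assms(3)
    weighted_norm_minus_commute[OF assms(1,2)] by linarith

text \<open>
  The image of the basis vector \<open>b\<close>, whose norm is \<open>q b\<close>, gives the bound on column \<open>b\<close>. The bounds
  suffice because an ultrametric sum is no larger than its largest term.
\<close>

lemma nonexpanding_iff:
  fixes A :: "'p::prime_card padic mat"
  assumes A: "A \<in> carrier_mat d d"
  shows "(\<forall>x\<in>carrier_vec d. weighted_norm d q (A *\<^sub>v x) \<le> weighted_norm d q x) \<longleftrightarrow>
    (\<forall>a<d. \<forall>b<d. q a * padic_norm (A $$ (a, b)) \<le> q b)"
proof (intro iffI allI impI ballI)
  fix a b assume ne: "\<forall>x\<in>carrier_vec d. weighted_norm d q (A *\<^sub>v x) \<le> weighted_norm d q x"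
    and a: "a < d" and b: "b < d"
  have "q a * padic_norm (A $$ (a, b)) \<le> weighted_norm d q (A *\<^sub>v unit_vec d b)"
    using weighted_norm_ge[OF a, of "A *\<^sub>v unit_vec d b"] mult_mat_unit_vec[OF A a b] by simp
  also have "\<dots> \<le> weighted_norm d q (unit_vec d b :: 'p padic vec)"
    using ne unit_vec_carrier by blast
  also have "\<dots> \<le> q b"
    unfolding weighted_norm_le_iff using pos[rule_format, OF b] b by (auto simp: unit_vec_def)
  finally show "q a * padic_norm (A $$ (a, b)) \<le> q b" .
next
  fix x :: "'p padic vec"
  assume bound: "\<forall>a<d. \<forall>b<d. q a * padic_norm (A $$ (a, b)) \<le> q b"
    and x: "x \<in> carrier_vec d"
  show "weighted_norm d q (A *\<^sub>v x) \<le> weighted_norm d q x"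
    unfolding weighted_norm_le_iff
  proof (intro allI impI)
    fix a assume a: "a < d"
    have "padic_norm (A $$ (a, b) * x $ b) \<le> weighted_norm d q x / q a" if "b < d" for b
    proof -
      have "q a * padic_norm (A $$ (a, b) * x $ b) \<le> q b * padic_norm (x $ b)"
        using bound a that by (simp add: padic_norm_mult mult_right_mono flip: mult.assoc)
      also have "\<dots> \<le> weighted_norm d q x"
        by (rule weighted_norm_ge[OF that])
      finally show ?thesis
        using pos[rule_format, OF a] by (simp add: field_simps)
    qed
    then have "padic_norm ((A *\<^sub>v x) $ a) \<le> weighted_norm d q x / q a"
      unfolding mult_mat_vec_index_sum[OF A x a]
      using pos[rule_format, OF a] by (intro padic_norm_sum_le) (auto simp: weighted_norm_nonneg)
    then show "q a * padic_norm ((A *\<^sub>v x) $ a) \<le> weighted_norm d q x"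
      using pos[rule_format, OF a] by (simp add: field_simps)
  qed
qed

lemma weighted_norm_mult_less:
  assumes E: "E \<in> carrier_mat d d" and x: "x \<in> carrier_vec d" "x \<noteq> 0\<^sub>v d"
    and small: "\<And>a b. a < d \<Longrightarrow> b < d \<Longrightarrow> q a * padic_norm (E $$ (a, b)) < q b"
  shows "weighted_norm d q (E *\<^sub>v x) < weighted_norm d q x"
  unfolding weighted_norm_less_iff
proof (intro allI impI)
  fix a assume a: "a < d"
  have "padic_norm (E $$ (a, b) * x $ b) < weighted_norm d q x / q a" if b: "b < d" for b
  proof (cases "x $ b = 0")
    case True
    then show ?thesis
      using weighted_norm_pos[OF x] pos[rule_format, OF a] by simp
  next
    case False
    then have "0 < padic_norm (x $ b)"
      using padic_norm_nonneg[of "x $ b"] by (simp add: order_less_le)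
    then have "q a * padic_norm (E $$ (a, b)) * padic_norm (x $ b) < q b * padic_norm (x $ b)"
      using small[OF a b] by (rule mult_strict_right_mono[rotated])
    also have "\<dots> \<le> weighted_norm d q x"
      by (rule weighted_norm_ge[OF b])
    finally show ?thesis
      using pos[rule_format, OF a] by (simp add: padic_norm_mult field_simps)
  qed
  then have "padic_norm ((E *\<^sub>v x) $ a) < weighted_norm d q x / q a"
    unfolding mult_mat_vec_index_sum[OF E x(1) a]
    using pos[rule_format, OF a] by (intro padic_norm_sum_less) (auto simp: weighted_norm_pos[OF x])
  then show "q a * padic_norm ((E *\<^sub>v x) $ a) < weighted_norm d q x"
    using pos[rule_format, OF a] by (simp add: field_simps)
qed

lemma isometry_iff:
  fixes A :: "'p::prime_card padic mat"
  shows "A \<in> carrier (isometry_group d (deformed_dist d q)) \<longleftrightarrow>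
    A \<in> carrier_mat d d \<and> (\<forall>x\<in>carrier_vec d. weighted_norm d q (A *\<^sub>v x) = weighted_norm d q x)"
proof -
  have "(\<forall>x\<in>carrier_vec d. \<forall>y\<in>carrier_vec d.
      deformed_dist d q (A *\<^sub>v x) (A *\<^sub>v y) = deformed_dist d q x y) \<longleftrightarrow>
    (\<forall>x\<in>carrier_vec d. weighted_norm d q (A *\<^sub>v x) = weighted_norm d q x)"
    (is "?L \<longleftrightarrow> ?R") if A: "A \<in> carrier_mat d d"
  proof -
    have dist: "deformed_dist d q (A *\<^sub>v x) (A *\<^sub>v y) = weighted_norm d q (A *\<^sub>v (x - y))"
      "deformed_dist d q x y = weighted_norm d q (x - y)"
      if "x \<in> carrier_vec d" "y \<in> carrier_vec d" for x y
      using that A mult_minus_distrib_mat_vec[OF A that]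
      by (simp_all add: deformed_dist_eq_weighted_norm)
    have "?R" if L: "?L"
    proof
      fix x :: "'p padic vec" assume x: "x \<in> carrier_vec d"
      then have "x - 0\<^sub>v d = x"
        by auto
      then show "weighted_norm d q (A *\<^sub>v x) = weighted_norm d q x"
        using L dist[OF x zero_carrier_vec] x by (metis zero_carrier_vec)
    qed
    moreover have "?L" if "?R"
      using that dist by simp
    ultimately show ?thesis by blast
  qed
  then show ?thesis
    by (auto simp: isometry_group_def)
qed

text \<open>
  This turns a condition on all vectors into finitely many bounds on entries, which can be compared
  for different weights \<open>q\<close>. The inverse exists since a norm-preserving map is injective, and it is
  what provides the inequality \<open>N x \<le> N (A x)\<close>.
\<close>

lemma isometry_iff_inverse:
  "A \<in> carrier (isometry_group d (deformed_dist d q)) \<longleftrightarrow>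
    A \<in> carrier_mat d d \<and> (\<exists>B\<in>carrier_mat d d. A * B = 1\<^sub>m d \<and> B * A = 1\<^sub>m d \<and>
      (\<forall>a<d. \<forall>b<d. q a * padic_norm (A $$ (a, b)) \<le> q b) \<and>
      (\<forall>a<d. \<forall>b<d. q a * padic_norm (B $$ (a, b)) \<le> q b))" (is "?L \<longleftrightarrow> ?R")
proof
  assume ?L
  then have A: "A \<in> carrier_mat d d"
    and iso: "\<And>x. x \<in> carrier_vec d \<Longrightarrow> weighted_norm d q (A *\<^sub>v x) = weighted_norm d q x"
    by (auto simp: isometry_iff)
  have "x = 0\<^sub>v d" if "x \<in> carrier_vec d" "A *\<^sub>v x = 0\<^sub>v d" for x
    using iso[OF that(1)] weighted_norm_pos[OF that(1)] that(2) by (metis less_irrefl weighted_norm_0)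
  then obtain B where B: "B \<in> carrier_mat d d" "A * B = 1\<^sub>m d" "B * A = 1\<^sub>m d"
    using inverse_mat_exists[OF A] by blast
  have "weighted_norm d q (B *\<^sub>v x) = weighted_norm d q x" if "x \<in> carrier_vec d" for x
    using iso[of "B *\<^sub>v x"] assoc_mult_mat_vec[OF A B(1) that] B that by simp
  then show ?R
    using A B iso nonexpanding_iff[OF A] nonexpanding_iff[OF B(1)] by auto
next
  assume ?R
  then obtain B where A: "A \<in> carrier_mat d d" and B: "B \<in> carrier_mat d d" "B * A = 1\<^sub>m d"
    and le: "\<And>x. x \<in> carrier_vec d \<Longrightarrow> weighted_norm d q (A *\<^sub>v x) \<le> weighted_norm d q x"
      "\<And>x. x \<in> carrier_vec d \<Longrightarrow> weighted_norm d q (B *\<^sub>v x) \<le> weighted_norm d q x"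
    using nonexpanding_iff by blast
  have "weighted_norm d q x \<le> weighted_norm d q (A *\<^sub>v x)" if "x \<in> carrier_vec d" for x
    using le(2)[of "A *\<^sub>v x"] assoc_mult_mat_vec[OF B(1) A that] A B that by simp
  with A le(1) show ?L
    by (simp add: isometry_iff order_antisym)
qed

lemma isometry_has_inverse:
  assumes "A \<in> carrier (isometry_group d (deformed_dist d q))"
  obtains B where "B \<in> carrier (isometry_group d (deformed_dist d q))" "A * B = 1\<^sub>m d" "B * A = 1\<^sub>m d"
proof -
  obtain B where "A \<in> carrier_mat d d" "B \<in> carrier_mat d d" "A * B = 1\<^sub>m d" "B * A = 1\<^sub>m d"
    "\<forall>a<d. \<forall>b<d. q a * padic_norm (A $$ (a, b)) \<le> q b"
    "\<forall>a<d. \<forall>b<d. q a * padic_norm (B $$ (a, b)) \<le> q b"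
    using assms unfolding isometry_iff_inverse by blast
  then show ?thesis
    by (intro that) (auto simp: isometry_iff_inverse)
qed

lemma isometry_one: "1\<^sub>m d \<in> carrier (isometry_group d (deformed_dist d q))"
  by (simp add: isometry_iff)

lemma isometry_mult:
  assumes "A \<in> carrier (isometry_group d (deformed_dist d q))"
    "B \<in> carrier (isometry_group d (deformed_dist d q))"
  shows "A * B \<in> carrier (isometry_group d (deformed_dist d q))"
proof -
  have A: "A \<in> carrier_mat d d" and B: "B \<in> carrier_mat d d"
    using assms by (auto simp: isometry_iff)
  have "weighted_norm d q (A * B *\<^sub>v x) = weighted_norm d q x" if "x \<in> carrier_vec d" for x
    using assms assoc_mult_mat_vec[OF A B that] that B by (simp add: isometry_iff)
  then show ?thesis
    using A B by (simp add: isometry_iff)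
qed

lemma isometry_group_is_group:
  "group (isometry_group d (deformed_dist d q) :: 'p::prime_card padic mat monoid)"
  (is "group ?G")
proof (rule groupI)
  have ops: "x \<otimes>\<^bsub>?G\<^esub> y = x * y" "\<one>\<^bsub>?G\<^esub> = 1\<^sub>m d" for x y
    by (simp_all add: isometry_group_def)
  have mat: "A \<in> carrier_mat d d" if "A \<in> carrier ?G" for A
    using that by (simp add: isometry_iff)
  fix A assume A: "A \<in> carrier ?G"
  show "\<one>\<^bsub>?G\<^esub> \<otimes>\<^bsub>?G\<^esub> A = A"
    using mat[OF A] by (simp add: ops)
  show "\<exists>B\<in>carrier ?G. B \<otimes>\<^bsub>?G\<^esub> A = \<one>\<^bsub>?G\<^esub>"
    unfolding ops using isometry_has_inverse[OF A] by metis
  fix B assume B: "B \<in> carrier ?G"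
  show "A \<otimes>\<^bsub>?G\<^esub> B \<in> carrier ?G"
    unfolding ops using A B by (rule isometry_mult)
  fix C assume C: "C \<in> carrier ?G"
  show "A \<otimes>\<^bsub>?G\<^esub> B \<otimes>\<^bsub>?G\<^esub> C = A \<otimes>\<^bsub>?G\<^esub> (B \<otimes>\<^bsub>?G\<^esub> C)"
    unfolding ops using mat[OF A] mat[OF B] mat[OF C] by simp
next
  show "\<one>\<^bsub>?G\<^esub> \<in> carrier ?G"
    using isometry_one by (simp add: isometry_group_def)
qed

text \<open>
  Under the bounds the perturbation moves each \<open>A' x\<close> with \<open>x \<noteq> 0\<close> by a vector of norm smaller than
  \<open>N x = N (A' x)\<close>, and in an ultrametric space such a change keeps the norm.
\<close>

lemma isometry_perturbation:
  fixes A :: "'p::prime_card padic mat"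
  assumes A: "A \<in> carrier_mat d d" and A': "A' \<in> carrier (isometry_group d (deformed_dist d q))"
    and small: "\<And>a b. a < d \<Longrightarrow> b < d \<Longrightarrow> q a * padic_norm (A $$ (a, b) - A' $$ (a, b)) < q b"
  shows "A \<in> carrier (isometry_group d (deformed_dist d q))"
  unfolding isometry_iff
proof (intro conjI ballI A)
  have A'm: "A' \<in> carrier_mat d d"
    using A' by (simp add: isometry_iff)
  fix x :: "'p padic vec" assume x: "x \<in> carrier_vec d"
  have iso: "weighted_norm d q (A' *\<^sub>v x) = weighted_norm d q x"
    using A' x by (simp add: isometry_iff)
  show "weighted_norm d q (A *\<^sub>v x) = weighted_norm d q x"
  proof (cases "x = 0\<^sub>v d")
    case True
    have "A *\<^sub>v 0\<^sub>v d = 0\<^sub>v d"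
      using A by (intro eq_vecI) auto
    with True show ?thesis
      by simp
  next
    case False
    have "weighted_norm d q ((A - A') *\<^sub>v x) < weighted_norm d q x"
      using A A'm x False small by (intro weighted_norm_mult_less) auto
    moreover have "(A - A') *\<^sub>v x = A *\<^sub>v x - A' *\<^sub>v x"
      using A A'm x by (simp add: minus_mult_distrib_mat_vec)
    ultimately show ?thesis
      using weighted_norm_isosceles[of "A *\<^sub>v x" "A' *\<^sub>v x"] iso A A'm x by simp
  qed
qed

end


section \<open>Comparing the deformed with the standard metric\<close>

context
  fixes d :: nat and q :: "nat \<Rightarrow> real"
  assumes d: "0 < d"
begin

lemma orthogonal_groupD:
  assumes "A \<in> carrier (orthogonal_group d)"
  obtains B where "A \<in> carrier_mat d d" "B \<in> carrier_mat d d" "A * B = 1\<^sub>m d" "B * A = 1\<^sub>m d"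
    "\<And>a b. a < d \<Longrightarrow> b < d \<Longrightarrow> padic_norm (A $$ (a, b)) \<le> 1"
    "\<And>a b. a < d \<Longrightarrow> b < d \<Longrightarrow> padic_norm (B $$ (a, b)) \<le> 1"
  using assms unfolding std_dist_eq_deformed_dist
  by (subst (asm) isometry_iff_inverse[OF d]) auto

lemma orthogonal_groupI:
  assumes "A \<in> carrier_mat d d" "B \<in> carrier_mat d d" "A * B = 1\<^sub>m d" "B * A = 1\<^sub>m d"
    "\<And>a b. a < d \<Longrightarrow> b < d \<Longrightarrow> padic_norm (A $$ (a, b)) \<le> 1"
    "\<And>a b. a < d \<Longrightarrow> b < d \<Longrightarrow> padic_norm (B $$ (a, b)) \<le> 1"
  shows "A \<in> carrier (orthogonal_group d)"
  unfolding std_dist_eq_deformed_dist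
  by (subst isometry_iff_inverse[OF d]) (use assms in auto)

text \<open>
  An entry at \<open>(a, b)\<close> with \<open>q a \<le> q b\<close> only has to be integral to satisfy the bound for the weights
  \<open>q\<close>; the other entries vanish, for the inverse because \<open>A\<close> preserves each of the coordinate
  subspaces spanned by the \<open>l\<close> with \<open>q l \<le> c\<close>.
\<close>

lemma triangular_orthogonal_is_isometry:
  fixes A :: "'p::prime_card padic mat"
  assumes pos: "\<forall>l<d. 0 < q l"
    and A: "A \<in> carrier (orthogonal_group d)"
    and zero: "\<And>a b. a < d \<Longrightarrow> b < d \<Longrightarrow> q b < q a \<Longrightarrow> A $$ (a, b) = 0"
  shows "A \<in> carrier (isometry_group d (deformed_dist d q))"
proof -
  obtain B where AB: "A \<in> carrier_mat d d" "B \<in> carrier_mat d d" "A * B = 1\<^sub>m d" "B * A = 1\<^sub>m d"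
    and A1: "\<And>a b. a < d \<Longrightarrow> b < d \<Longrightarrow> padic_norm (A $$ (a, b)) \<le> 1"
    and B1: "\<And>a b. a < d \<Longrightarrow> b < d \<Longrightarrow> padic_norm (B $$ (a, b)) \<le> 1"
    using orthogonal_groupD[OF A] by metis
  have B0: "B $$ (a, b) = 0" if "a < d" "b < d" "q b < q a" for a b
    by (rule inverse_mat_preserves_coordinate_subspace[OF AB(1,2,4), where S = "{l. q l \<le> q b}"])
       (use that zero in auto)
  have bound: "q a * padic_norm (M $$ (a, b)) \<le> q b"
    if "a < d" "b < d" "padic_norm (M $$ (a, b)) \<le> 1" "q b < q a \<Longrightarrow> M $$ (a, b) = 0"
    for a b and M :: "'p padic mat"
  proof (cases "q b < q a")
    case False
    then have "q a * padic_norm (M $$ (a, b)) \<le> q b * 1"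
      using that pos[rule_format, OF that(1)] pos[rule_format, OF that(2)] by (intro mult_mono) auto
    then show ?thesis by simp
  qed (use that pos[rule_format, OF that(2)] in simp)
  show ?thesis
    unfolding isometry_iff_inverse[OF d pos]
  proof (intro conjI bexI[of _ B] allI impI AB)
    fix a b assume "a < d" "b < d"
    then show "q a * padic_norm (A $$ (a, b)) \<le> q b" "q a * padic_norm (B $$ (a, b)) \<le> q b"
      using A1 B1 zero B0 bound by metis+
  qed
qed

lemma isometry_iff_block_triangular:
  assumes range: "\<forall>l<d. q l \<in> {1 / real CARD('p::prime_card)<..1}"
  shows "(A :: 'p padic mat) \<in> carrier (isometry_group d (deformed_dist d q)) \<longleftrightarrow>
    A \<in> carrier (orthogonal_group d) \<and>
    (\<forall>a<d. \<forall>b<d. q b < q a \<longrightarrow> padic_norm (A $$ (a, b)) < 1)"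
proof -
  note q = range[rule_format]
  have p0: "real CARD('p) > 0"
    using prime_gt_0_nat[OF prime_card] by simp
  have q0: "0 < q l" if "l < d" for l
  proof -
    have "0 < 1 / real CARD('p)"
      using p0 by simp
    also have "\<dots> < q l"
      using q[OF that] by simp
    finally show ?thesis .
  qed
  then have pos: "\<forall>l<d. 0 < q l"
    by blast
  show ?thesis
  proof (intro iffI conjI allI impI)
    assume A: "A \<in> carrier (isometry_group d (deformed_dist d q))"
    then obtain B where AB: "A \<in> carrier_mat d d" "B \<in> carrier_mat d d" "A * B = 1\<^sub>m d" "B * A = 1\<^sub>m d"
      and A1: "\<And>a b. a < d \<Longrightarrow> b < d \<Longrightarrow> q a * padic_norm (A $$ (a, b)) \<le> q b"
      and B1: "\<And>a b. a < d \<Longrightarrow> b < d \<Longrightarrow> q a * padic_norm (B $$ (a, b)) \<le> q b"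
      by (subst (asm) isometry_iff_inverse[OF d pos]) auto
    have integral: "padic_norm x \<le> 1" if ab: "a < d" "b < d" and x: "q a * padic_norm x \<le> q b"
      for a b and x :: "'p padic"
    proof (rule padic_norm_less_prime)
      have "padic_norm x \<le> q b / q a"
        using x q0[OF ab(1)] by (simp add: field_simps)
      also have "\<dots> \<le> 1 / q a"
        using q[OF ab(2)] q0[OF ab(1)] by (intro divide_right_mono) auto
      also have "\<dots> < real CARD('p)"
        using q[OF ab(1)] q0[OF ab(1)] p0 by (simp add: field_simps)
      finally show "padic_norm x < real CARD('p)" .
    qed
    show "A \<in> carrier (orthogonal_group d)"
      by (rule orthogonal_groupI[OF AB]) (use integral[OF _ _ A1] integral[OF _ _ B1] in simp_all)
    fix a b assume ab: "a < d" "b < d" "q b < q a"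
    then have "q a * padic_norm (A $$ (a, b)) < q a * 1"
      using A1[OF ab(1,2)] by simp
    then show "padic_norm (A $$ (a, b)) < 1"
      using q0[OF ab(1)] by simp
  next
    assume "A \<in> carrier (orthogonal_group d) \<and>
      (\<forall>a<d. \<forall>b<d. q b < q a \<longrightarrow> padic_norm (A $$ (a, b)) < 1)"
    then have A: "A \<in> carrier (orthogonal_group d)"
      and less1: "\<And>a b. a < d \<Longrightarrow> b < d \<Longrightarrow> q b < q a \<Longrightarrow> padic_norm (A $$ (a, b)) < 1"
      by auto
    have Am: "A \<in> carrier_mat d d"
      using A by (simp add: isometry_group_def)
    \<comment> \<open>\<open>T\<close> is close to \<open>A\<close> for the weights \<open>1\<close>, which gives its orthogonality, and for the
      weights \<open>q\<close>, which carries the isometry property back to \<open>A\<close>.\<close>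
    define T where "T = mat d d (\<lambda>(a, b). if q b < q a then 0 else A $$ (a, b))"
    have Tm: "T \<in> carrier_mat d d"
      by (simp add: T_def)
    have "T \<in> carrier (isometry_group d (deformed_dist d (\<lambda>_. 1)))"
      by (rule isometry_perturbation[OF d _ Tm A[unfolded std_dist_eq_deformed_dist]])
         (use less1 in \<open>auto simp: T_def\<close>)
    then have "T \<in> carrier (isometry_group d (deformed_dist d q))"
      by (intro triangular_orthogonal_is_isometry pos)
         (auto simp: std_dist_eq_deformed_dist T_def)
    then show "A \<in> carrier (isometry_group d (deformed_dist d q))"
    proof (rule isometry_perturbation[OF d pos Am])
      fix a b assume ab: "a < d" "b < d"
      show "q a * padic_norm (A $$ (a, b) - T $$ (a, b)) < q b"
      proof (cases "q b < q a")
        case True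
        have "q a * padic_norm (A $$ (a, b)) \<le> 1 * (1 / real CARD('p))"
          using q[OF ab(1)] q0[OF ab(1)] padic_norm_less_1[OF less1[OF ab True]]
          by (intro mult_mono) auto
        then show ?thesis
          using True ab q[OF ab(2)] by (simp add: T_def)
      qed (use ab q0 in \<open>simp add: T_def\<close>)
    qed
  qed
qed

end

theorem lemma3:
  fixes d r :: nat and q :: "nat \<Rightarrow> real" and D :: "nat \<Rightarrow> nat"
  defines "O_d \<equiv> (orthogonal_group d :: 'p::prime_card padic mat monoid)"
    and "O_q \<equiv> (isometry_group d (deformed_dist d q) :: 'p padic mat monoid)"
  assumes "d \<ge> 1"
    and "\<And>l. l < d \<Longrightarrow> q l \<in> {1 / real CARD('p)<..1}"
    and "mono_on {..<d} q"
    and "D 0 = 0" and "D r = d" and "strict_mono_on {..r} D"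
    and "\<And>a b. a < d \<Longrightarrow> b < d \<Longrightarrow>
           q a = q b \<longleftrightarrow> (\<exists>i<r. a \<in> {D i..<D (Suc i)} \<and> b \<in> {D i..<D (Suc i)})"
  shows "group O_d \<and> subgroup (carrier O_q) O_d \<and>
    carrier O_q = {A \<in> carrier O_d. \<forall>a<d. \<forall>b<a.
      \<not> (\<exists>i<r. a \<in> {D i..<D (Suc i)} \<and> b \<in> {D i..<D (Suc i)}) \<longrightarrow>
      A $$ (a, b) \<in> padic_maximal_ideal} \<and>
    carrier O_q = {A \<in> carrier O_d. \<forall>a<d. \<forall>b<a.
      q a \<noteq> q b \<longrightarrow> A $$ (a, b) \<in> padic_maximal_ideal}"
proof -
  have d0: "0 < d"
    using assms(3) by simp
  have q_range: "\<forall>l<d. q l \<in> {1 / real CARD('p)<..1}"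
    using assms(4) by blast
  have q0: "0 < q l" if "l < d" for l
  proof -
    have "0 \<le> 1 / real CARD('p)" by simp
    also have "\<dots> < q l" using q_range that by simp
    finally show ?thesis .
  qed
  then have pos: "\<forall>l<d. 0 < q l"
    by blast
  have carrier_q: "carrier O_q = {A \<in> carrier O_d. \<forall>a<d. \<forall>b<a.
      q a \<noteq> q b \<longrightarrow> A $$ (a, b) \<in> padic_maximal_ideal}"
  proof -
    have lower: "b < a \<and> q a \<noteq> q b \<longleftrightarrow> q b < q a" if "a < d" "b < d" for a b
      using mono_onD[OF assms(5), of a b] mono_onD[OF assms(5), of b a] that
      by (cases a b rule: linorder_cases) auto
    have "(\<forall>b<d. q b < q a \<longrightarrow> padic_norm (A $$ (a, b)) < 1) \<longleftrightarrow>
        (\<forall>b<a. q a \<noteq> q b \<longrightarrow> padic_norm (A $$ (a, b)) < 1)"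
      if "a < d" for a and A :: "'p padic mat"
      by (metis lower[OF that] that less_trans)
    then have "(\<forall>a<d. \<forall>b<d. q b < q a \<longrightarrow> padic_norm (A $$ (a, b)) < 1) \<longleftrightarrow>
        (\<forall>a<d. \<forall>b<a. q a \<noteq> q b \<longrightarrow> A $$ (a, b) \<in> padic_maximal_ideal)" for A :: "'p padic mat"
      unfolding padic_maximal_ideal_iff by simp
    then have "A \<in> carrier O_q \<longleftrightarrow> A \<in> carrier O_d \<and>
        (\<forall>a<d. \<forall>b<a. q a \<noteq> q b \<longrightarrow> A $$ (a, b) \<in> padic_maximal_ideal)" for A
      unfolding O_q_def O_d_def isometry_iff_block_triangular[OF d0 q_range] by simp
    then show ?thesis
      by (simp add: set_eq_iff)
  qed
  have blocks: "(\<exists>i<r. a \<in> {D i..<D (Suc i)} \<and> b \<in> {D i..<D (Suc i)}) \<longleftrightarrow> q a = q b"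
    if "a < d" "b < a" for a b
    using assms(9)[of a b] that by auto
  have grp: "group O_d"
    unfolding O_d_def std_dist_eq_deformed_dist by (rule isometry_group_is_group[OF d0]) simp
  have ops: "x \<otimes>\<^bsub>O_d\<^esub> y = x * y" "\<one>\<^bsub>O_d\<^esub> = 1\<^sub>m d" for x y
    by (simp_all add: O_d_def isometry_group_def)
  have sub: "subgroup (carrier O_q) O_d"
  proof (rule group.subgroupI[OF grp])
    show incl: "carrier O_q \<subseteq> carrier O_d"
      by (simp add: carrier_q subset_iff)
    show "carrier O_q \<noteq> {}"
      unfolding O_q_def using isometry_one[OF d0 pos] by blast
    fix A assume A: "A \<in> carrier O_q"
    then obtain B where B: "B \<in> carrier O_q" "B * A = 1\<^sub>m d"
      using isometry_has_inverse[OF d0 pos] unfolding O_q_def by metis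
    then have "inv\<^bsub>O_d\<^esub> A = B"
      using group.inv_equality[OF grp, of B A] A incl by (auto simp: ops)
    with B show "inv\<^bsub>O_d\<^esub> A \<in> carrier O_q"
      by simp
    fix C assume "C \<in> carrier O_q"
    then show "A \<otimes>\<^bsub>O_d\<^esub> C \<in> carrier O_q"
      unfolding ops using A isometry_mult[OF d0 pos] unfolding O_q_def by blast
  qed
  have "carrier O_q = {A \<in> carrier O_d. \<forall>a<d. \<forall>b<a.
      \<not> (\<exists>i<r. a \<in> {D i..<D (Suc i)} \<and> b \<in> {D i..<D (Suc i)}) \<longrightarrow>
      A $$ (a, b) \<in> padic_maximal_ideal}"
    unfolding carrier_q using blocks by simp
  with grp sub carrier_q show ?thesis
    by (intro conjI)
qed

end
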